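(* Let $n_1\ge n_2$, $\rho>0$, and let $A\in\mathbb{R}^{n_1\times n_2}$ be nonzero. Let $A=U\Sigma V^T$ be a singular value decomposition, where $U\in\mathbb{R}^{n_1\times n_1}$ and $V\in\mathbb{R}^{n_2\times n_2}$ are orthogonal matrices and $\Sigma=\begin{pmatrix}\mathrm{Diag}(\sigma)\\0\end{pmatrix}\in\mathbb{R}^{n_1\times n_2}$ with $\sigma=(\sigma_1,\dots,\sigma_{n_2})^T$, $\sigma_1\ge\dots\ge\sigma_{n_2}\ge0$. Then $$U\begin{pmatrix}\mathrm{Diag}(d_\rho(\sigma))\\0\end{pmatrix}V^T$$ is an optimal solution to $\min_{L\in\mathbb{R}^{n_1\times n_2}}\ \|L-A\|_F+\rho\|L\|_*$.
   Context: $\|\cdot\|_F$ and $\|\cdot\|_*$ are the Frobenius and nuclear norms; $\mathrm{Diag}(v)$ is the square diagonal matrix with diagonal $v$. For a nonnegative nonzero vector $a\in\mathbb{R}^{n_2}$ (with $\|a\|_0$ its number of nonzero entries), $d_\rho(a)\in\mathbb{R}^{n_2}$ is defined by $$d_\rho(a)=\begin{cases}0,&\text{if }\rho\ge\frac{\|a\|_\infty}{\|a\|_2},\\ \arg\min_{s\in\mathbb{R}^{n_2}}\{\|s-a\|_2+\rho\|s\|_1\},&\text{if }\frac{1}{\sqrt{\|a\|_0}}<\rho<\frac{\|a\|_\infty}{\|a\|_2},\\ a,&\text{if }\rho\le\frac{1}{\sqrt{\|a\|_0}}.\end{cases}$$ In the middle case the minimizer is unique. One always has $\frac{1}{\sqrt{\|a\|_0}}\le\frac{\|a\|_\infty}{\|a\|_2}$;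 the first and third cases overlap only when $\rho=\frac{1}{\sqrt{\|a\|_0}}=\frac{\|a\|_\infty}{\|a\|_2}$, and cases are then read in the order listed. *)

theory Defs
  imports
    "Jordan_Normal_Form.Matrix"
    "Jordan_Normal_Form.Char_Poly"
    Complex_Main
begin

(* Everything is over the reals: a vector in R^n is a member of carrier_vec n, and
   its entries are indexed from 0. *)

definition l0_norm :: "real vec \<Rightarrow> nat" where
  "l0_norm v = card {i. i < dim_vec v \<and> v $ i \<noteq> 0}"

definition l1_norm :: "real vec \<Rightarrow> real" where
  "l1_norm v = (\<Sum>i<dim_vec v. \<bar>v $ i\<bar>)"

definition l2_norm :: "real vec \<Rightarrow> real" where
  "l2_norm v = sqrt (\<Sum>i<dim_vec v. (v $ i)\<^sup>2)"

(* Meaningful only for vectors of positive dimension. *)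
definition linf_norm :: "real vec \<Rightarrow> real" where
  "linf_norm v = Max ((\<lambda>i. \<bar>v $ i\<bar>) ` {..<dim_vec v})"

definition frobenius_norm :: "real mat \<Rightarrow> real" where
  "frobenius_norm M = sqrt (\<Sum>i<dim_row M. \<Sum>j<dim_col M. (M $$ (i, j))\<^sup>2)"

(* The singular values of M are the square roots of the eigenvalues of M\<^sup>T M. Each
   occurs as often as its multiplicity as a root of the characteristic polynomial. *)
definition singular_values :: "real mat \<Rightarrow> real multiset" where
  "singular_values M = image_mset sqrt (proots (char_poly (transpose_mat M * M)))"

definition nuclear_norm :: "real mat \<Rightarrow> real" where
  "nuclear_norm M = sum_mset (singular_values M)"

(* The library predicate orthogonal_mat requires only that the columns be nonzero and
   pairwise orthogonal, so it is not used here. *)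
definition orthogonal_square_mat :: "nat \<Rightarrow> real mat \<Rightarrow> bool" where
  "orthogonal_square_mat n Q \<longleftrightarrow>
     Q \<in> carrier_mat n n \<and> transpose_mat Q * Q = 1\<^sub>m n \<and> Q * transpose_mat Q = 1\<^sub>m n"

definition Diag :: "real vec \<Rightarrow> real mat" where
  "Diag v = mat_diag (dim_vec v) (\<lambda>i. v $ i)"

(* The m-by-n matrix with Diag v on top of a zero block, where n = dim_vec v;
   it is meant for n \<le> m. *)
definition rect_diag :: "nat \<Rightarrow> real vec \<Rightarrow> real mat" where
  "rect_diag m v = Diag v @\<^sub>r 0\<^sub>m (m - dim_vec v) (dim_vec v)"

(* Intended for nonnegative nonzero a. The first and the last case overlap when
   1 / sqrt (l0_norm a) = linf_norm a / l2_norm a = \<rho>; then the first one applies. In the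
   middle case the minimizer is unique, so arg_min does not make an arbitrary choice. *)
definition d_vec :: "real \<Rightarrow> real vec \<Rightarrow> real vec" where
  "d_vec \<rho> a =
     (if \<rho> \<ge> linf_norm a / l2_norm a then 0\<^sub>v (dim_vec a)
      else if 1 / sqrt (real (l0_norm a)) < \<rho>
        then arg_min (\<lambda>s. l2_norm (s - a) + \<rho> * l1_norm s) (\<lambda>s. s \<in> carrier_vec (dim_vec a))
      else a)"

end

theory Submission
  imports Defs "HOL-Analysis.L2_Norm"
begin

text \<open>
  The proof exhibits a dual certificate. A matrix \<open>Z\<close> with Frobenius norm at most 1 and operator norm
  at most \<open>\<rho>\<close> bounds the objective from below by a constant: writing \<open>\<langle>M, N\<rangle>\<close> for the trace inner
  product, Cauchy-Schwarz gives \<open>\<langle>Z, A - L\<rangle> \<le> \<parallel>L - A\<parallel>\<^sub>F\<close>, and the duality between the operator norm and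
  the nuclear norm gives \<open>\<langle>Z, L\<rangle> \<le> \<rho> \<parallel>L\<parallel>\<^sub>*\<close>; adding the two, the objective at every \<open>L\<close> is at least
  \<open>\<langle>Z, A\<rangle>\<close>. It remains to choose \<open>Z\<close> so that the proposed solution attains this bound.

  The certificate is taken in the singular frame of \<open>A\<close>, as \<open>Z = U (Diag u; 0) V\<^sup>T\<close>. Both norms are
  invariant under \<open>U\<close> and \<open>V\<close>, so what is needed is a vector \<open>u\<close> with Euclidean norm at most 1,
  all entries at most \<open>\<rho>\<close> in absolute value, and
  \<open>u \<bullet> \<sigma> = \<parallel>d - \<sigma>\<parallel>\<^sub>2 + \<rho> \<parallel>d\<parallel>\<^sub>1\<close> for \<open>d = d_vec \<rho> \<sigma>\<close>: a dual certificate for the vector problem.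
  Lemma \<open>d_vec_certificate\<close> supplies it. If \<open>d = 0\<close>, it is \<open>\<sigma>\<close> scaled to length 1; if \<open>d = \<sigma>\<close>,
  it is \<open>\<rho>\<close> on the support of \<open>\<sigma>\<close>. Between these, the minimum of the vector problem is attained by soft
  thresholding: some \<open>t > 0\<close> satisfies \<open>t\<^sup>2 = \<rho>\<^sup>2 \<Sum> min(\<sigma>\<^sub>i, t)\<^sup>2\<close>, and \<open>u\<^sub>i = (\<rho> / t) min(\<sigma>\<^sub>i, t)\<close>
  certifies that \<open>\<sigma>\<^sub>i - min(\<sigma>\<^sub>i, t)\<close> is a minimizer. So a minimizer exists, and the one chosen by
  \<open>arg_min\<close> has the same value.

  The bound \<open>\<langle>Z, L\<rangle> \<le> \<rho> \<parallel>L\<parallel>\<^sub>*\<close> is lemma \<open>mat_inner_le_nuclear_norm\<close>. The nuclear norm is here a sum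
  over the real roots of the characteristic polynomial of \<open>L\<^sup>T L\<close>, so the argument needs that this
  polynomial splits and that an orthonormal eigenbasis \<open>q\<^sub>j\<close> exists, that is, the spectral theorem
  for real symmetric matrices (\<open>real_spectral_theorem\<close>). In that basis
  \<open>\<langle>Z, L\<rangle> = \<Sum> (Z q\<^sub>j) \<bullet> (L q\<^sub>j) \<le> \<Sum> \<rho> \<parallel>L q\<^sub>j\<parallel>\<close>, and the \<open>\<parallel>L q\<^sub>j\<parallel>\<close> are the singular values.
\<close>

section \<open>The vector problem and its dual\<close>

lemma l2_norm_L2_set: "l2_norm v = L2_set (\<lambda>i. v $ i) {..<dim_vec v}"
  by (simp add: l2_norm_def L2_set_def)

lemma sum_mult_le_L2_set:
  fixes f g :: "'a \<Rightarrow> real"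
  shows "(\<Sum>i\<in>S. f i * g i) \<le> L2_set f S * L2_set g S"
proof -
  have "(\<Sum>i\<in>S. f i * g i) \<le> (\<Sum>i\<in>S. \<bar>f i\<bar> * \<bar>g i\<bar>)"
    by (intro sum_mono) (metis abs_ge_self abs_mult)
  also have "\<dots> \<le> L2_set f S * L2_set g S" by (rule L2_set_mult_ineq)
  finally show ?thesis .
qed

lemma scalar_prod_le_l2_norm:
  assumes "u \<in> carrier_vec n" "v \<in> carrier_vec n"
  shows "u \<bullet> v \<le> l2_norm u * l2_norm v"
  using sum_mult_le_L2_set[of "\<lambda>i. u $ i" "\<lambda>i. v $ i" "{..<n}"] assms
  by (simp add: l2_norm_L2_set scalar_prod_def atLeast0LessThan)

lemma l2_norm_power2: "(l2_norm v)\<^sup>2 = v \<bullet> v"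
  by (simp add: l2_norm_def scalar_prod_def atLeast0LessThan sum_nonneg power2_eq_square[symmetric])

lemma scalar_prod_le_l1_norm:
  assumes "u \<in> carrier_vec n" "s \<in> carrier_vec n" and "\<forall>i<n. \<bar>u $ i\<bar> \<le> \<rho>"
  shows "u \<bullet> s \<le> \<rho> * l1_norm s"
proof -
  have "u \<bullet> s = (\<Sum>i<n. u $ i * s $ i)"
    using assms by (simp add: scalar_prod_def atLeast0LessThan)
  also have "\<dots> \<le> (\<Sum>i<n. \<rho> * \<bar>s $ i\<bar>)"
  proof (rule sum_mono)
    fix i assume "i \<in> {..<n}"
    then have "\<bar>u $ i\<bar> * \<bar>s $ i\<bar> \<le> \<rho> * \<bar>s $ i\<bar>"
      using assms(3) by (intro mult_right_mono) auto
    then show "u $ i * s $ i \<le> \<rho> * \<bar>s $ i\<bar>"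
      by (metis abs_ge_self abs_mult order_trans)
  qed
  finally show ?thesis using assms by (simp add: l1_norm_def sum_distrib_left)
qed

text \<open>
  Such a \<open>u\<close> is feasible for the dual problem, whose objective is \<open>u \<bullet> a\<close>: by Cauchy-Schwarz \<open>u \<bullet> (a - s)\<close> is at most the
  distance term, and \<open>u \<bullet> s\<close> is at most the penalty.
  A vector \<open>s\<close> for which equality holds is therefore a minimizer.
\<close>
lemma weak_duality:
  assumes "u \<in> carrier_vec n" "s \<in> carrier_vec n" "a \<in> carrier_vec n"
    and "l2_norm u \<le> 1" and "\<forall>i<n. \<bar>u $ i\<bar> \<le> \<rho>"
  shows "u \<bullet> a \<le> l2_norm (s - a) + \<rho> * l1_norm s"
proof -
  have "u \<bullet> (a - s) = u \<bullet> a - u \<bullet> s"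
    by (rule scalar_prod_minus_distrib[OF assms(1,3,2)])
  moreover have "u \<bullet> (a - s) \<le> l2_norm u * l2_norm (a - s)"
    using assms by (intro scalar_prod_le_l2_norm) auto
  moreover have "l2_norm (a - s) = l2_norm (s - a)"
    using assms by (simp add: l2_norm_def power2_commute)
  moreover have "l2_norm u * l2_norm (a - s) \<le> 1 * l2_norm (a - s)"
    using assms(4) by (intro mult_right_mono) (auto simp: l2_norm_def sum_nonneg)
  moreover have "u \<bullet> s \<le> \<rho> * l1_norm s"
    using scalar_prod_le_l1_norm[OF assms(1,2,5)] .
  ultimately show ?thesis by linarith
qed

lemma l2_norm_pos:
  assumes "a \<noteq> 0\<^sub>v (dim_vec a)" shows "l2_norm a > 0"
proof -
  obtain i where "i < dim_vec a" "a $ i \<noteq> 0"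
    using assms by (metis eq_vecI index_zero_vec)
  then have "0 < (\<Sum>i<dim_vec a. (a $ i)\<^sup>2)"
    by (intro sum_pos2[of _ i]) auto
  then show ?thesis by (simp add: l2_norm_def)
qed

lemma abs_le_linf_norm: "i < dim_vec v \<Longrightarrow> \<bar>v $ i\<bar> \<le> linf_norm v"
  unfolding linf_norm_def by (intro Max_ge) auto

text \<open>
  For a nonnegative vector this is the usual shrinkage \<open>max (a\<^sub>i - t) 0\<close>; the subtracted part
  \<open>min (a\<^sub>i) t\<close> is the residual, which is also the direction of the certificate.
\<close>
definition soft_threshold :: "real \<Rightarrow> real vec \<Rightarrow> real vec" where
  "soft_threshold t a = vec (dim_vec a) (\<lambda>i. a $ i - min (a $ i) t)"

text \<open>
  Stationarity of the objective at \<open>soft_threshold t a\<close> says \<open>t / \<parallel>residual\<parallel> = \<rho>\<close>, which is the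
  equation for \<open>t\<close> here. The two bounds on \<open>\<rho>\<close> give exactly the signs needed for the intermediate value
  theorem: at the least positive entry of \<open>a\<close> the residual is constant on the support,
  so \<open>\<rho>\<^sup>2 \<parallel>a\<parallel>\<^sub>0 > 1\<close> decides the sign, and at the largest entry the residual is all of \<open>a\<close>.
\<close>
lemma threshold_exists:
  assumes nonneg: "\<forall>i<dim_vec a. a $ i \<ge> 0" and nz: "a \<noteq> 0\<^sub>v (dim_vec a)" and "\<rho> > 0"
    and lower: "1 / sqrt (real (l0_norm a)) < \<rho>"
    and upper: "\<rho> < linf_norm a / l2_norm a"
  shows "\<exists>t>0. t\<^sup>2 = \<rho>\<^sup>2 * (\<Sum>i<dim_vec a. (min (a $ i) t)\<^sup>2)"
proof -
  define n where "n = dim_vec a"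
  define S where "S = {i. i < n \<and> a $ i \<noteq> 0}"
  define h where "h t = \<rho>\<^sup>2 * (\<Sum>i<n. (min (a $ i) t)\<^sup>2) - t\<^sup>2" for t
  define m where "m = Min ((\<lambda>i. a $ i) ` S)"
  define M where "M = linf_norm a"
  have finS: "finite S" by (simp add: S_def)
  obtain j where j: "j \<in> S"
    using nz by (metis (mono_tags, lifting) S_def eq_vecI index_zero_vec mem_Collect_eq n_def)
  have "m \<in> (\<lambda>i. a $ i) ` S" unfolding m_def using finS j by (intro Min_in) auto
  then obtain k where k: "k \<in> S" "m = a $ k" by auto
  have m_pos: "m > 0" using k nonneg by (auto simp: S_def n_def order_less_le)
  have m_le: "m \<le> a $ i" if "i \<in> S" for i
    unfolding m_def using finS that by (intro Min_le) auto
  have le_M: "a $ i \<le> M" if "i < n" for i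
    using abs_le_linf_norm[of i a] that by (simp add: M_def n_def)
  have "m \<le> M" using k le_M by (auto simp: S_def)
  have h_m: "0 \<le> h m"
  proof -
    have "(\<Sum>i<n. (min (a $ i) m)\<^sup>2) = (\<Sum>i\<in>S. m\<^sup>2)"
    proof (rule sum.mono_neutral_cong_right)
      show "\<forall>i\<in>{..<n} - S. (min (a $ i) m)\<^sup>2 = 0"
        using m_pos by (auto simp: S_def)
      show "(min (a $ i) m)\<^sup>2 = m\<^sup>2" if "i \<in> S" for i
        using m_le[OF that] by (simp add: min_def)
    qed (auto simp: S_def)
    then have sum_m: "(\<Sum>i<n. (min (a $ i) m)\<^sup>2) = real (l0_norm a) * m\<^sup>2"
      by (simp add: l0_norm_def S_def n_def)
    have "card S > 0" using finS j by (auto simp: card_gt_0_iff)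
    then have l0: "real (l0_norm a) > 0" by (simp add: l0_norm_def S_def n_def)
    then have "1 < \<rho> * sqrt (real (l0_norm a))" using lower by (simp add: field_simps)
    then have "1 \<le> (\<rho> * sqrt (real (l0_norm a)))\<^sup>2" by (simp add: one_le_power)
    then have "1 \<le> \<rho>\<^sup>2 * real (l0_norm a)" using l0 by (simp add: power_mult_distrib)
    then have "1 * m\<^sup>2 \<le> (\<rho>\<^sup>2 * real (l0_norm a)) * m\<^sup>2" by (rule mult_right_mono) simp
    then show ?thesis by (simp add: h_def sum_m algebra_simps)
  qed
  have h_M: "h M \<le> 0"
  proof -
    have "(\<Sum>i<n. (min (a $ i) M)\<^sup>2) = (\<Sum>i<n. (a $ i)\<^sup>2)"
      using le_M by (intro sum.cong) (auto simp: min_def)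
    then have sum_M: "(\<Sum>i<n. (min (a $ i) M)\<^sup>2) = (l2_norm a)\<^sup>2"
      by (simp add: l2_norm_def n_def sum_nonneg)
    have "\<rho> * l2_norm a \<le> M"
      using upper l2_norm_pos[OF nz] by (simp add: M_def field_simps)
    moreover have "0 \<le> \<rho> * l2_norm a" using \<open>\<rho> > 0\<close> l2_norm_pos[OF nz] by simp
    ultimately have "(\<rho> * l2_norm a)\<^sup>2 \<le> M\<^sup>2" by (intro power_mono)
    then show ?thesis by (simp add: h_def sum_M power_mult_distrib)
  qed
  have cont: "isCont h t" for t unfolding h_def by (intro continuous_intros)
  obtain t where t: "m \<le> t" "h t = 0"
    using IVT2[of h M 0 m] h_m h_M \<open>m \<le> M\<close> cont by auto
  then show ?thesis using m_pos by (intro exI[of _ t]) (auto simp: h_def n_def)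
qed

text \<open>
  The certificate is the residual \<open>min (a\<^sub>i) t\<close> scaled by \<open>\<rho> / t\<close>. By the equation for \<open>t\<close> it has
  length 1, so its product with the residual is the distance; and wherever the thresholded vector is
  nonzero the residual is \<open>t\<close>, so the certificate is \<open>\<rho>\<close> there and its product with the thresholded
  vector is the penalty.
\<close>
lemma soft_threshold_certificate:
  assumes "\<forall>i<dim_vec a. a $ i \<ge> 0" and "\<rho> > 0" and "t > 0"
    and t: "t\<^sup>2 = \<rho>\<^sup>2 * (\<Sum>i<dim_vec a. (min (a $ i) t)\<^sup>2)"
  defines "u \<equiv> vec (dim_vec a) (\<lambda>i. \<rho> / t * min (a $ i) t)"
    and "s \<equiv> soft_threshold t a"
  shows "l2_norm u = 1" and "\<forall>i<dim_vec a. \<bar>u $ i\<bar> \<le> \<rho>"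
    and "l2_norm (s - a) + \<rho> * l1_norm s = u \<bullet> a"
proof -
  let ?n = "dim_vec a"
  let ?m = "\<lambda>i. min (a $ i) t"
  have nonneg: "0 \<le> ?m i" if "i < ?n" for i using assms that by auto
  have sum_m: "(\<Sum>i<?n. (?m i)\<^sup>2) = (t / \<rho>)\<^sup>2"
    using t \<open>\<rho> > 0\<close> by (simp add: field_simps)
  have "(\<Sum>i<?n. (u $ i)\<^sup>2) = (\<rho> / t)\<^sup>2 * (\<Sum>i<?n. (?m i)\<^sup>2)"
    by (simp add: u_def power_mult_distrib power_divide sum_distrib_left)
  also have "\<dots> = 1" using \<open>\<rho> > 0\<close> \<open>t > 0\<close> by (simp add: sum_m field_simps)
  finally show "l2_norm u = 1" by (simp add: l2_norm_def u_def)
  show "\<forall>i<?n. \<bar>u $ i\<bar> \<le> \<rho>"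
  proof (intro allI impI)
    fix i assume i: "i < ?n"
    have "\<rho> / t * ?m i \<le> \<rho> / t * t" using \<open>\<rho> > 0\<close> \<open>t > 0\<close> by (intro mult_left_mono) auto
    then show "\<bar>u $ i\<bar> \<le> \<rho>" using i nonneg[OF i] \<open>\<rho> > 0\<close> \<open>t > 0\<close> by (simp add: u_def)
  qed
  have "(\<Sum>i<?n. ((s - a) $ i)\<^sup>2) = (\<Sum>i<?n. (?m i)\<^sup>2)"
    by (intro sum.cong) (auto simp: s_def soft_threshold_def)
  then have dist: "l2_norm (s - a) = t / \<rho>"
    using \<open>\<rho> > 0\<close> \<open>t > 0\<close> by (simp add: l2_norm_def sum_m)
  have "u \<bullet> a = (\<Sum>i<?n. \<rho> / t * (?m i)\<^sup>2 + \<rho> * \<bar>s $ i\<bar>)"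
    unfolding scalar_prod_def atLeast0LessThan
  proof (intro sum.cong refl)
    fix i assume "i \<in> {..<?n}"
    then show "u $ i * a $ i = \<rho> / t * (?m i)\<^sup>2 + \<rho> * \<bar>s $ i\<bar>"
      using \<open>t > 0\<close> by (auto simp: u_def s_def soft_threshold_def min_def power2_eq_square field_simps)
  qed
  also have "\<dots> = \<rho> / t * (t / \<rho>)\<^sup>2 + \<rho> * l1_norm s"
    unfolding sum.distrib sum_distrib_left[symmetric] sum_m
    by (simp add: l1_norm_def s_def soft_threshold_def)
  also have "\<rho> / t * (t / \<rho>)\<^sup>2 = l2_norm (s - a)"
    using \<open>\<rho> > 0\<close> \<open>t > 0\<close> by (simp add: dist power2_eq_square)
  finally show "l2_norm (s - a) + \<rho> * l1_norm s = u \<bullet> a" by simp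
qed

text \<open>
  Strong duality for the vector problem. Membership in \<open>carrier_vec n\<close> belongs to the conclusion because
  it rests on the same argument: \<open>arg_min\<close> is unspecified unless a minimizer exists.
\<close>
lemma d_vec_certificate:
  assumes a: "a \<in> carrier_vec n" and nonneg: "\<forall>i<n. a $ i \<ge> 0" and nz: "a \<noteq> 0\<^sub>v n" and "\<rho> > 0"
  shows "d_vec \<rho> a \<in> carrier_vec n \<and>
    (\<exists>u\<in>carrier_vec n. l2_norm u \<le> 1 \<and> (\<forall>i<n. \<bar>u $ i\<bar> \<le> \<rho>) \<and>
       l2_norm (d_vec \<rho> a - a) + \<rho> * l1_norm (d_vec \<rho> a) = u \<bullet> a)"
proof -
  have dim: "dim_vec a = n" using a by auto
  have pos: "l2_norm a > 0" using l2_norm_pos nz dim by simp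
  consider (zero) "\<rho> \<ge> linf_norm a / l2_norm a"
    | (mid) "\<rho> < linf_norm a / l2_norm a" "1 / sqrt (real (l0_norm a)) < \<rho>"
    | (id) "\<rho> < linf_norm a / l2_norm a" "\<rho> \<le> 1 / sqrt (real (l0_norm a))"
    by linarith
  then show ?thesis
  proof cases
    case zero
    \<comment> \<open>The certificate is the unit vector along \<open>a\<close>: the distance from \<open>0\<close> to \<open>a\<close> is its product with \<open>a\<close>.\<close>
    define u where "u = (1 / l2_norm a) \<cdot>\<^sub>v a"
    have u: "u \<in> carrier_vec n" using a by (simp add: u_def)
    have sq: "a \<bullet> a = (l2_norm a)\<^sup>2" by (rule l2_norm_power2[symmetric])
    have "u \<bullet> u = 1" using a pos by (simp add: u_def sq power2_eq_square)
    then have "l2_norm u = 1"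
      using l2_norm_power2[of u] by (simp add: power2_eq_1_iff l2_norm_def sum_nonneg)
    moreover have "\<bar>u $ i\<bar> \<le> \<rho>" if "i < n" for i
    proof -
      have "\<bar>u $ i\<bar> = \<bar>a $ i\<bar> / l2_norm a" using that dim pos by (simp add: u_def)
      also have "\<dots> \<le> linf_norm a / l2_norm a"
        using abs_le_linf_norm[of i a] that dim pos by (intro divide_right_mono) auto
      finally show ?thesis using zero by linarith
    qed
    moreover have "l2_norm (0\<^sub>v n - a) = l2_norm a" using dim by (simp add: l2_norm_def)
    moreover have "l1_norm (0\<^sub>v n) = 0" by (simp add: l1_norm_def)
    moreover have "u \<bullet> a = l2_norm a"
      using a pos by (simp add: u_def sq power2_eq_square)
    moreover have "d_vec \<rho> a = 0\<^sub>v n" using zero dim by (simp add: d_vec_def)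
    ultimately show ?thesis using u by (intro conjI bexI[of _ u]) auto
  next
    case mid
    let ?f = "\<lambda>s. l2_norm (s - a) + \<rho> * l1_norm s"
    let ?P = "\<lambda>s. s \<in> carrier_vec n"
    obtain t where t: "t > 0" "t\<^sup>2 = \<rho>\<^sup>2 * (\<Sum>i<dim_vec a. (min (a $ i) t)\<^sup>2)"
      using threshold_exists[of a \<rho>] nonneg nz mid \<open>\<rho> > 0\<close> dim by auto
    define s where "s = soft_threshold t a"
    define u where "u = vec n (\<lambda>i. \<rho> / t * min (a $ i) t)"
    have u: "u \<in> carrier_vec n" and s: "s \<in> carrier_vec n"
      using dim by (auto simp: u_def s_def soft_threshold_def)
    have cert: "l2_norm u = 1" "\<forall>i<n. \<bar>u $ i\<bar> \<le> \<rho>" "?f s = u \<bullet> a"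
      using soft_threshold_certificate[of a \<rho> t] nonneg t \<open>\<rho> > 0\<close> dim
      by (simp_all add: u_def s_def)
    have lower: "u \<bullet> a \<le> ?f y" if "?P y" for y
      using weak_duality[OF u that a] cert by simp
    \<comment> \<open>The explicit minimizer guarantees that \<open>arg_min\<close> picks a minimizer, hence the same value.\<close>
    have "is_arg_min ?f ?P s"
      using s lower cert(3) by (fastforce simp: is_arg_min_def not_less)
    then have "is_arg_min ?f ?P (arg_min ?f ?P)"
      unfolding arg_min_def by (rule someI)
    moreover have "d_vec \<rho> a = arg_min ?f ?P" using mid dim by (simp add: d_vec_def)
    ultimately have d: "is_arg_min ?f ?P (d_vec \<rho> a)" by simp
    then have "?f (d_vec \<rho> a) \<le> ?f s" using s by (simp add: is_arg_min_def not_less)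
    moreover have "?P (d_vec \<rho> a)" using d by (simp add: is_arg_min_def)
    ultimately have "?f (d_vec \<rho> a) = u \<bullet> a" using lower[of "d_vec \<rho> a"] cert(3) by linarith
    then show ?thesis
      using u cert \<open>?P (d_vec \<rho> a)\<close> by (intro conjI bexI[of _ u]) auto
  next
    case id
    \<comment> \<open>Only the penalty is left at \<open>s = a\<close>, so \<open>u\<close> must be \<open>\<rho>\<close> on the whole support of \<open>a\<close>.\<close>
    define u where "u = vec n (\<lambda>i. if a $ i = 0 then 0 else \<rho>)"
    have u: "u \<in> carrier_vec n" by (simp add: u_def)
    have "(\<Sum>i<n. (u $ i)\<^sup>2) = (\<Sum>i | i < n \<and> a $ i \<noteq> 0. \<rho>\<^sup>2)"
      by (rule sum.mono_neutral_cong_right) (auto simp: u_def)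
    also have "\<dots> = real (l0_norm a) * \<rho>\<^sup>2" using dim by (simp add: l0_norm_def)
    finally have sum_u: "(\<Sum>i<n. (u $ i)\<^sup>2) = real (l0_norm a) * \<rho>\<^sup>2" .
    \<comment> \<open>Otherwise the bound \<open>1 / sqrt 0\<close>, which equals \<open>0\<close>, would contradict \<open>\<rho> > 0\<close>.\<close>
    have "l0_norm a \<noteq> 0" using id \<open>\<rho> > 0\<close> by (auto intro!: Nat.gr0I)
    then have "\<rho> * sqrt (real (l0_norm a)) \<le> 1" using id by (simp add: field_simps)
    then have "(\<rho> * sqrt (real (l0_norm a)))\<^sup>2 \<le> 1" using \<open>\<rho> > 0\<close> by (simp add: power_le_one)
    then have "l2_norm u \<le> 1"
      using sum_u by (simp add: l2_norm_def u_def power_mult_distrib algebra_simps)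
    moreover have "\<forall>i<n. \<bar>u $ i\<bar> \<le> \<rho>" using \<open>\<rho> > 0\<close> by (simp add: u_def)
    moreover have "l2_norm (a - a) + \<rho> * l1_norm a = u \<bullet> a"
      using dim nonneg
      by (auto simp: l2_norm_def l1_norm_def u_def scalar_prod_def atLeast0LessThan sum_distrib_left
          intro!: sum.cong)
    moreover have "d_vec \<rho> a = a" using id by (simp add: d_vec_def)
    ultimately show ?thesis using u a by auto
  qed
qed

section \<open>Real symmetric matrices and the spectral theorem\<close>

lemma adjoint_scalar_prod:
  fixes A :: "'a :: comm_semiring_0 mat"
  assumes "A \<in> carrier_mat m n" "x \<in> carrier_vec n" "y \<in> carrier_vec m"
  shows "(A *\<^sub>v x) \<bullet> y = x \<bullet> (transpose_mat A *\<^sub>v y)"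
proof -
  have "(A *\<^sub>v x) \<bullet> y = y \<bullet> (A *\<^sub>v x)"
    using assms by (intro comm_scalar_prod[of _ m]) auto
  also have "\<dots> = (transpose_mat A *\<^sub>v y) \<bullet> x"
    using assms by (intro transpose_vec_mult_scalar[symmetric]) auto
  also have "\<dots> = x \<bullet> (transpose_mat A *\<^sub>v y)"
    using assms by (intro comm_scalar_prod[of _ n]) auto
  finally show ?thesis .
qed

text \<open>
  For a complex eigenvector \<open>x\<close>, moving \<open>B\<close> across the Hermitian product \<open>B x \<bullet>c x\<close> turns the factor
  \<open>c\<close> into its conjugate.
\<close>
lemma symmetric_eigenvalue_real:
  fixes B :: "real mat"
  assumes B: "B \<in> carrier_mat n n" and sym: "transpose_mat B = B"
    and ev: "eigenvalue (map_mat complex_of_real B) c"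
  shows "c \<in> \<real>"
proof -
  let ?B = "map_mat complex_of_real B"
  have B': "?B \<in> carrier_mat n n" using B by simp
  obtain x where x: "x \<in> carrier_vec n" "x \<noteq> 0\<^sub>v n" "?B *\<^sub>v x = c \<cdot>\<^sub>v x"
    using ev B unfolding eigenvalue_def eigenvector_def by auto
  have cx: "conjugate x \<in> carrier_vec n" using x by simp
  have "transpose_mat ?B = ?B" using sym by (metis map_mat_transpose)
  have conjB: "?B *\<^sub>v conjugate x = conjugate (?B *\<^sub>v x)"
    using B x(1) by (intro eq_vecI) (auto simp: scalar_prod_def)
  have "c * (x \<bullet>c x) = (?B *\<^sub>v x) \<bullet>c x" using x cx by simp
  also have "\<dots> = x \<bullet> (?B *\<^sub>v conjugate x)"
    using adjoint_scalar_prod[OF B' x(1) cx] \<open>transpose_mat ?B = ?B\<close> by simp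
  also have "\<dots> = cnj c * (x \<bullet>c x)"
    using x cx by (simp add: conjB conjugate_smult_vec)
  finally have "c * (x \<bullet>c x) = cnj c * (x \<bullet>c x)" .
  moreover have "x \<bullet>c x \<noteq> 0" using x conjugate_square_eq_0_vec by blast
  ultimately have "c = cnj c" by simp
  then show ?thesis by (simp add: Reals_cnj_iff)
qed

lemma symmetric_has_eigenvalue:
  fixes B :: "real mat"
  assumes B: "B \<in> carrier_mat n n" and sym: "transpose_mat B = B" and "n > 0"
  shows "\<exists>e. eigenvalue B e"
proof -
  let ?B = "map_mat complex_of_real B"
  have B': "?B \<in> carrier_mat n n" using B by simp
  have "degree (char_poly ?B) = n" using degree_monic_char_poly[OF B'] by simp
  then have "\<not> constant (poly (char_poly ?B))" using \<open>n > 0\<close> by (simp add: constant_degree)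
  then obtain c where c: "poly (char_poly ?B) c = 0"
    using fundamental_theorem_of_algebra by blast
  then have "eigenvalue ?B c" using eigenvalue_root_char_poly[OF B'] by simp
  then have "c \<in> \<real>" by (rule symmetric_eigenvalue_real[OF B sym])
  then obtain e where "c = complex_of_real e" by (auto elim: Reals_cases)
  moreover have "char_poly ?B = map_poly complex_of_real (char_poly B)"
    by (rule of_real_hom.char_poly_hom[OF B])
  ultimately have "poly (char_poly B) e = 0" using c by simp
  then show ?thesis using eigenvalue_root_char_poly[OF B] by auto
qed

lemma orthogonal_square_matI:
  assumes "Q \<in> carrier_mat n n" "transpose_mat Q * Q = 1\<^sub>m n"
  shows "orthogonal_square_mat n Q"
  using assms mat_mult_left_right_inverse[of "transpose_mat Q" n Q]
  by (simp add: orthogonal_square_mat_def)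

lemma orthogonal_square_mat_mult:
  assumes "orthogonal_square_mat n P" "orthogonal_square_mat n Q"
  shows "orthogonal_square_mat n (P * Q)"
proof (rule orthogonal_square_matI)
  have P: "P \<in> carrier_mat n n" and Q: "Q \<in> carrier_mat n n"
    using assms by (auto simp: orthogonal_square_mat_def)
  then show "P * Q \<in> carrier_mat n n" by simp
  have "transpose_mat (P * Q) * (P * Q) = (transpose_mat Q * transpose_mat P) * (P * Q)"
    using P Q by (simp add: transpose_mult)
  also have "\<dots> = transpose_mat Q * ((transpose_mat P * P) * Q)"
    using P Q by (simp add: assoc_mult_mat[of _ n n _ n _ n])
  also have "\<dots> = 1\<^sub>m n" using assms Q by (simp add: orthogonal_square_mat_def)
  finally show "transpose_mat (P * Q) * (P * Q) = 1\<^sub>m n" .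
qed

lemma orthogonal_square_mat_transpose:
  "orthogonal_square_mat n Q \<Longrightarrow> orthogonal_square_mat n (transpose_mat Q)"
  by (auto simp: orthogonal_square_mat_def)

lemma orthogonal_scalar_prod:
  assumes "orthogonal_square_mat n Q" "x \<in> carrier_vec n" "y \<in> carrier_vec n"
  shows "(Q *\<^sub>v x) \<bullet> (Q *\<^sub>v y) = x \<bullet> y"
proof -
  have Q: "Q \<in> carrier_mat n n" using assms by (simp add: orthogonal_square_mat_def)
  have "(Q *\<^sub>v x) \<bullet> (Q *\<^sub>v y) = x \<bullet> (transpose_mat Q *\<^sub>v (Q *\<^sub>v y))"
    using Q assms by (intro adjoint_scalar_prod) auto
  also have "transpose_mat Q *\<^sub>v (Q *\<^sub>v y) = (transpose_mat Q * Q) *\<^sub>v y"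
    using Q assms by (simp add: assoc_mult_mat_vec[of _ n n _ n])
  finally show ?thesis using assms by (simp add: orthogonal_square_mat_def)
qed

text \<open>
  The reflection that exchanges \<open>v\<close> and the first basis vector is \<open>x \<mapsto> x - 2 (w \<bullet> x) / (w \<bullet> w) w\<close> with
  \<open>w = v - e\<^sub>0\<close>. It extends a unit vector to an orthonormal basis, and being symmetric and involutive it
  turns conjugation by an orthogonal matrix into \<open>H * B * H\<close>. If \<open>v = e\<^sub>0\<close>, then \<open>w = 0\<close> and the
  identity matrix takes its place.
\<close>
lemma householder_reflection:
  assumes v: "v \<in> carrier_vec n" and unit: "v \<bullet> v = (1::real)" and "n > 0"
  shows "\<exists>H. orthogonal_square_mat n H \<and> transpose_mat H = H \<and> H *\<^sub>v unit_vec n 0 = v"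
proof (cases "v = unit_vec n 0")
  case True
  then show ?thesis
    using \<open>n > 0\<close> by (intro exI[of _ "1\<^sub>m n"]) (auto simp: orthogonal_square_mat_def)
next
  case False
  define w where "w = v - unit_vec n 0"
  have w: "w \<in> carrier_vec n" using v by (simp add: w_def)
  define c where "c = 2 / (w \<bullet> w)"
  define H where "H = mat n n (\<lambda>(i, j). (if i = j then 1 else 0) - c * w $ i * w $ j)"
  have H: "H \<in> carrier_mat n n" by (simp add: H_def)
  have "w \<noteq> 0\<^sub>v n"
  proof
    assume w0: "w = 0\<^sub>v n"
    have "v = unit_vec n 0"
    proof (rule eq_vecI)
      fix i assume "i < dim_vec (unit_vec n 0 :: real vec)"
      then have "i < n" by simp
      then have "w $ i = 0" using w0 by simp
      then show "v $ i = unit_vec n 0 $ i" using \<open>i < n\<close> v by (simp add: w_def)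
    qed (use v in simp)
    with False show False by simp
  qed
  then have ww: "w \<bullet> w \<noteq> 0" using w conjugate_square_eq_0_vec[of w n] by simp
  have sym: "transpose_mat H = H" by (auto simp: H_def)
  have apply_H: "H *\<^sub>v x = x - (c * (w \<bullet> x)) \<cdot>\<^sub>v w" if x: "x \<in> carrier_vec n" for x
  proof (rule eq_vecI)
    fix i assume "i < dim_vec (x - (c * (w \<bullet> x)) \<cdot>\<^sub>v w)"
    then have i: "i < n" using w by simp
    have "(H *\<^sub>v x) $ i = (\<Sum>j<n. (if i = j then x $ j else 0) - c * w $ i * (w $ j * x $ j))"
      using i x by (auto simp: H_def scalar_prod_def atLeast0LessThan algebra_simps intro!: sum.cong)
    also have "\<dots> = x $ i - c * w $ i * (w \<bullet> x)"
      using i x by (simp add: sum_subtractf sum_distrib_left[symmetric] scalar_prod_def atLeast0LessThan)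
    finally show "(H *\<^sub>v x) $ i = (x - (c * (w \<bullet> x)) \<cdot>\<^sub>v w) $ i"
      using i x w by simp
  qed (use w H in simp)
  have "orthogonal_square_mat n H"
  proof (rule orthogonal_square_matI[OF H], rule mat_col_eqI)
    fix j assume "j < dim_col (1\<^sub>m n :: real mat)"
    then have j: "j < n" by simp
    let ?x = "unit_vec n j :: real vec"
    let ?y = "?x - (c * (w \<bullet> ?x)) \<cdot>\<^sub>v w"
    have "col H j = H *\<^sub>v ?x"
      using col_mult2[OF H one_carrier_mat j] H j by simp
    then have "col (transpose_mat H * H) j = H *\<^sub>v (H *\<^sub>v ?x)"
      using col_mult2[OF H H j] by (simp add: sym)
    also have "\<dots> = ?y - (c * (w \<bullet> ?y)) \<cdot>\<^sub>v w"
      using w by (simp add: apply_H)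
    also have "w \<bullet> ?y = - (w \<bullet> ?x)"
      using w ww by (simp add: scalar_prod_minus_distrib[of _ n] c_def)
    also have "?y - (c * - (w \<bullet> ?x)) \<cdot>\<^sub>v w = ?x"
      using w by (intro eq_vecI) auto
    finally show "col (transpose_mat H * H) j = col (1\<^sub>m n) j" using j by simp
  qed (use H in auto)
  moreover have "H *\<^sub>v unit_vec n 0 = v"
  proof -
    have w0: "w \<bullet> unit_vec n 0 = v $ 0 - 1"
      using w v \<open>n > 0\<close> by (simp add: scalar_prod_right_unit) (simp add: w_def)
    \<comment> \<open>Both \<open>w \<bullet> w = 2 (1 - v\<^sub>0)\<close> and \<open>w \<bullet> e\<^sub>0 = v\<^sub>0 - 1\<close>, so the coefficient of \<open>w\<close> in \<open>H e\<^sub>0\<close> is \<open>1\<close>.\<close>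
    have "w \<bullet> w = w \<bullet> v - w \<bullet> unit_vec n 0"
      unfolding w_def using v by (intro scalar_prod_minus_distrib[of _ n]) auto
    also have "w \<bullet> v = 1 - v $ 0"
      using v \<open>n > 0\<close> by (simp add: w_def minus_scalar_prod_distrib[of _ n] unit scalar_prod_left_unit)
    finally have "c * (w \<bullet> unit_vec n 0) = - 1"
      using ww w0 by (simp add: c_def field_simps)
    then show ?thesis
      using v w by (subst apply_H) (auto simp: w_def)
  qed
  ultimately show ?thesis using sym by blast
qed

text \<open>
  Deflation: a reflection that carries the first basis vector to a unit eigenvector clears
  the first column of the matrix below the diagonal.
\<close>
lemma eigenvector_reflection:
  fixes B :: "real mat"
  assumes B: "B \<in> carrier_mat n n" and sym: "transpose_mat B = B" and "n > 0"
  shows "\<exists>H e. orthogonal_square_mat n H \<and> transpose_mat H = H \<and>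
    col (H * B * H) 0 = e \<cdot>\<^sub>v unit_vec n 0"
proof -
  obtain e v where v: "v \<in> carrier_vec n" "v \<noteq> 0\<^sub>v n" "B *\<^sub>v v = e \<cdot>\<^sub>v v"
    using symmetric_has_eigenvalue[OF assms] B unfolding eigenvalue_def eigenvector_def by auto
  have pos: "v \<bullet> v > 0" using v conjugate_square_greater_0_vec[of v n] by simp
  define u where "u = (1 / sqrt (v \<bullet> v)) \<cdot>\<^sub>v v"
  have u: "u \<in> carrier_vec n" using v by (simp add: u_def)
  have unit: "u \<bullet> u = 1" using v pos by (simp add: u_def)
  have eig: "B *\<^sub>v u = e \<cdot>\<^sub>v u"
    using v B by (simp add: u_def mult_mat_vec[of _ n n] smult_smult_assoc mult.commute)
  obtain H where H: "orthogonal_square_mat n H" "transpose_mat H = H" "H *\<^sub>v unit_vec n 0 = u"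
    using householder_reflection[OF u unit \<open>n > 0\<close>] by auto
  have Hc: "H \<in> carrier_mat n n" and HH: "H * H = 1\<^sub>m n"
    using H by (auto simp: orthogonal_square_mat_def)
  let ?e0 = "unit_vec n 0 :: real vec"
  have "H *\<^sub>v u = (H * H) *\<^sub>v ?e0"
    using Hc by (simp add: H(3)[symmetric] assoc_mult_mat_vec[of _ n n _ n])
  then have Hu: "H *\<^sub>v u = ?e0" by (simp add: HH)
  have "col (H * B * H) 0 = (H * B) *\<^sub>v col H 0"
    using Hc B \<open>n > 0\<close> by (intro col_mult2[of _ n n _ n]) auto
  also have "col H 0 = u"
    using col_mult2[OF Hc one_carrier_mat \<open>n > 0\<close>] Hc \<open>n > 0\<close> H(3) by simp
  also have "(H * B) *\<^sub>v u = H *\<^sub>v (e \<cdot>\<^sub>v u)"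
    using Hc B u by (simp add: assoc_mult_mat_vec[of _ n n _ n] eig)
  also have "\<dots> = e \<cdot>\<^sub>v ?e0" using Hc u by (simp add: mult_mat_vec[of _ n n] Hu)
  finally show ?thesis using H by blast
qed

text \<open>
  Induction on the size. After the reflection the matrix is symmetric with first column \<open>e\<close> times the
  first basis vector, hence block diagonal, and the remaining block is diagonalized by the
  induction hypothesis.
\<close>
lemma real_spectral_theorem:
  fixes B :: "real mat"
  assumes "B \<in> carrier_mat n n" and "transpose_mat B = B"
  shows "\<exists>Q d. orthogonal_square_mat n Q \<and> transpose_mat Q * B * Q = mat_diag n d"
  using assms
proof (induction n arbitrary: B)
  case 0
  then show ?case
    by (intro exI[of _ "1\<^sub>m 0"] exI[of _ "\<lambda>_. 0"]) (auto simp: orthogonal_square_mat_def mat_diag_def)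
next
  case (Suc n)
  let ?N = "Suc n"
  note B = \<open>B \<in> carrier_mat ?N ?N\<close>
  obtain H e where H: "orthogonal_square_mat ?N H" "transpose_mat H = H"
    "col (H * B * H) 0 = e \<cdot>\<^sub>v unit_vec ?N 0"
    using eigenvector_reflection[OF Suc.prems] by auto
  have Hc: "H \<in> carrier_mat ?N ?N" using H by (auto simp: orthogonal_square_mat_def)
  define C where "C = H * B * H"
  have C: "C \<in> carrier_mat ?N ?N" using Hc B by (simp add: C_def)
  have symC: "transpose_mat C = C"
  proof -
    have "transpose_mat C = H * (B * H)"
      using Hc B H Suc.prems(2) by (simp add: C_def transpose_mult[of _ ?N ?N _ ?N])
    also have "\<dots> = C" using Hc B by (simp add: C_def assoc_mult_mat[of _ ?N ?N _ ?N _ ?N])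
    finally show ?thesis .
  qed
  have C_flip: "C $$ (j, i) = C $$ (i, j)" if "i < ?N" "j < ?N" for i j
    using arg_cong[OF symC, of "\<lambda>X. X $$ (i, j)"] that C by simp
  have C_col: "C $$ (i, 0) = (if i = 0 then e else 0)" if "i < ?N" for i
    using arg_cong[OF H(3)[folded C_def], of "\<lambda>x. x $ i"] that C by simp
  define E where "E = mat 1 1 (\<lambda>_. e)"
  define C' where "C' = mat n n (\<lambda>(i, j). C $$ (Suc i, Suc j))"
  have C': "C' \<in> carrier_mat n n" and E: "E \<in> carrier_mat 1 1" by (auto simp: C'_def E_def)
  have block: "C = four_block_mat E (0\<^sub>m 1 n) (0\<^sub>m n 1) C'"
  proof (rule eq_matI)
    fix i j
    assume "i < dim_row (four_block_mat E (0\<^sub>m 1 n) (0\<^sub>m n 1) C')"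
      "j < dim_col (four_block_mat E (0\<^sub>m 1 n) (0\<^sub>m n 1) C')"
    then have ij: "i < ?N" "j < ?N" using C' E by auto
    then show "C $$ (i, j) = four_block_mat E (0\<^sub>m 1 n) (0\<^sub>m n 1) C' $$ (i, j)"
      using C_col[of i] C_col[of j] C_flip[of 0 j] by (cases i; cases j) (auto simp: C'_def E_def)
  qed (use C C' E in auto)
  have "transpose_mat C' = C'" using C_flip by (auto simp: C'_def)
  then obtain Q d where Q: "orthogonal_square_mat n Q" "transpose_mat Q * C' * Q = mat_diag n d"
    using Suc.IH[OF C'] by auto
  have Qc: "Q \<in> carrier_mat n n" using Q by (auto simp: orthogonal_square_mat_def)
  define P where "P = four_block_mat (1\<^sub>m 1) (0\<^sub>m 1 n) (0\<^sub>m n 1) Q"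
  have P: "P \<in> carrier_mat ?N ?N" using Qc four_block_carrier_mat[of "1\<^sub>m 1" 1 1 Q n n] by (simp add: P_def)
  have PT: "transpose_mat P = four_block_mat (1\<^sub>m 1) (0\<^sub>m 1 n) (0\<^sub>m n 1) (transpose_mat Q)"
    unfolding P_def using Qc by (subst transpose_four_block_mat[of _ 1 1 _ n _ n]) auto
  have "transpose_mat P * P = four_block_mat (1\<^sub>m 1) (0\<^sub>m 1 n) (0\<^sub>m n 1) (1\<^sub>m n)"
    unfolding PT unfolding P_def using Qc Q(1)
    by (subst mult_four_block_mat[of _ 1 1 _ n _ n _ _ 1 _ n])
      (auto simp: orthogonal_square_mat_def)
  also have "\<dots> = 1\<^sub>m ?N" by (rule eq_matI) auto
  finally have "orthogonal_square_mat ?N P" by (intro orthogonal_square_matI P)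
  with H(1) have orth: "orthogonal_square_mat ?N (H * P)" by (rule orthogonal_square_mat_mult)
  have "transpose_mat (H * P) * B * (H * P) = transpose_mat P * C * P"
  proof -
    have "transpose_mat (H * P) = transpose_mat P * H"
      using Hc P H(2) by (simp add: transpose_mult[of _ ?N ?N _ ?N])
    then show ?thesis
      using Hc P B by (simp add: C_def assoc_mult_mat[of _ ?N ?N _ ?N _ ?N])
  qed
  also have "transpose_mat P * C = four_block_mat E (0\<^sub>m 1 n) (0\<^sub>m n 1) (transpose_mat Q * C')"
    unfolding PT block using Qc C' E
    by (subst mult_four_block_mat[of _ 1 1 _ n _ n _ _ 1 _ n]) auto
  also have "\<dots> * P = four_block_mat E (0\<^sub>m 1 n) (0\<^sub>m n 1) (mat_diag n d)"
    unfolding P_def using Qc C' E Q(2)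
    by (subst mult_four_block_mat[of _ 1 1 _ n _ n _ _ 1 _ n]) auto
  also have "\<dots> = mat_diag ?N (case_nat e d)"
    by (rule eq_matI) (auto simp: E_def mat_diag_def split: nat.split)
  finally show ?case using orth by blast
qed

section \<open>The trace inner product and the nuclear norm\<close>

text \<open>
  Similar matrices have the same characteristic polynomial, so any orthogonal diagonalization of
  \<open>M\<^sup>T M\<close> displays the roots with their multiplicities.
\<close>
lemma nuclear_norm_diagonalized:
  assumes M: "M \<in> carrier_mat m n" and Q: "orthogonal_square_mat n Q"
    and diag: "transpose_mat Q * (transpose_mat M * M) * Q = mat_diag n d"
  shows "nuclear_norm M = (\<Sum>i<n. sqrt (d i))"
proof -
  let ?B = "transpose_mat M * M"
  have Qc: "Q \<in> carrier_mat n n" and B: "?B \<in> carrier_mat n n"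
    using Q M by (auto simp: orthogonal_square_mat_def)
  have "similar_mat_wit (mat_diag n d) ?B (transpose_mat Q) Q"
    using Qc B Q diag by (intro similar_mat_witI[of _ _ n]) (auto simp: orthogonal_square_mat_def)
  then have "char_poly (mat_diag n d) = char_poly ?B"
    by (intro char_poly_similar) (auto simp: similar_mat_def)
  moreover have "char_poly (mat_diag n d) = (\<Prod>e\<leftarrow>diag_mat (mat_diag n d). [:- e, 1:])"
    by (rule char_poly_upper_triangular[of _ n]) (auto simp: mat_diag_def upper_triangular_def)
  moreover have "diag_mat (mat_diag n d) = map d [0..<n]"
    by (auto simp: diag_mat_def mat_diag_def)
  ultimately have cp: "char_poly ?B = (\<Prod>i\<leftarrow>[0..<n]. [:- d i, 1:])"
    by (simp add: o_def)
  have nz: "(\<Prod>i\<leftarrow>xs. [:- d i, 1:]) \<noteq> 0" for xs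
    by (auto simp: prod_list_zero_iff)
  have "proots (\<Prod>i\<leftarrow>xs. [:- d i, 1:]) = mset (map d xs)" for xs
  proof (induction xs)
    case (Cons a xs)
    have "proots ([:- d a, 1:] * (\<Prod>i\<leftarrow>xs. [:- d i, 1:]))
        = proots [:- d a, 1:] + proots (\<Prod>i\<leftarrow>xs. [:- d i, 1:])"
      by (rule proots_mult) (use nz in auto)
    then show ?case using Cons by (simp del: mult_pCons_left)
  qed simp
  then have "singular_values M = mset (map (\<lambda>i. sqrt (d i)) [0..<n])"
    unfolding singular_values_def cp by (simp add: image_mset.compositionality o_def)
  then have "nuclear_norm M = sum_list (map (\<lambda>i. sqrt (d i)) [0..<n])"
    unfolding nuclear_norm_def by (simp only: sum_mset_sum_list)
  also have "\<dots> = (\<Sum>i<n. sqrt (d i))"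
    by (simp add: interv_sum_list_conv_sum_set_nat atLeast0LessThan)
  finally show ?thesis .
qed

text \<open>
  The trace inner product \<open>tr (M\<^sup>T N)\<close>, in coordinates. The sum ranges over the dimensions of the first
  argument, so it is meaningful when both matrices have the same size.
\<close>
definition mat_inner :: "real mat \<Rightarrow> real mat \<Rightarrow> real" where
  "mat_inner M N = (\<Sum>i<dim_row M. \<Sum>j<dim_col M. M $$ (i, j) * N $$ (i, j))"

lemma frobenius_norm_eq_sqrt: "frobenius_norm M = sqrt (mat_inner M M)"
  by (simp add: frobenius_norm_def mat_inner_def power2_eq_square)

lemma mat_inner_cols:
  assumes "M \<in> carrier_mat m n" "N \<in> carrier_mat m n"
  shows "mat_inner M N = (\<Sum>j<n. col M j \<bullet> col N j)"
proof -
  have "mat_inner M N = (\<Sum>j<n. \<Sum>i<m. M $$ (i, j) * N $$ (i, j))"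
    using assms unfolding mat_inner_def by (subst sum.swap) auto
  also have "\<dots> = (\<Sum>j<n. col M j \<bullet> col N j)"
    using assms by (auto simp: scalar_prod_def atLeast0LessThan intro!: sum.cong)
  finally show ?thesis .
qed

lemma mat_inner_transpose:
  assumes "M \<in> carrier_mat m n" "N \<in> carrier_mat m n"
  shows "mat_inner (transpose_mat M) (transpose_mat N) = mat_inner M N"
  using assms unfolding mat_inner_def by (subst sum.swap) auto

lemma mat_inner_minus_right:
  assumes "M \<in> carrier_mat m n" "N \<in> carrier_mat m n" "N' \<in> carrier_mat m n"
  shows "mat_inner M (N - N') = mat_inner M N - mat_inner M N'"
  using assms by (simp add: mat_inner_def sum_subtractf right_diff_distrib)

lemma mat_inner_orthogonal_left:
  assumes U: "orthogonal_square_mat m U" and M: "M \<in> carrier_mat m n" and N: "N \<in> carrier_mat m n"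
  shows "mat_inner (U * M) (U * N) = mat_inner M N"
proof -
  have Uc: "U \<in> carrier_mat m m" using U by (simp add: orthogonal_square_mat_def)
  have "mat_inner (U * M) (U * N) = (\<Sum>j<n. col (U * M) j \<bullet> col (U * N) j)"
    using Uc M N by (intro mat_inner_cols[of _ m]) auto
  also have "\<dots> = (\<Sum>j<n. col M j \<bullet> col N j)"
    using Uc M N by (intro sum.cong)
      (auto simp: col_mult2[of _ m m _ n] simp del: col_mult intro!: orthogonal_scalar_prod[OF U])
  also have "\<dots> = mat_inner M N" using M N by (rule mat_inner_cols[symmetric])
  finally show ?thesis .
qed

lemma mat_inner_orthogonal_right:
  assumes V: "orthogonal_square_mat n V" and M: "M \<in> carrier_mat m n" and N: "N \<in> carrier_mat m n"
  shows "mat_inner (M * V) (N * V) = mat_inner M N"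
proof -
  have Vc: "V \<in> carrier_mat n n" using V by (simp add: orthogonal_square_mat_def)
  have "mat_inner (M * V) (N * V) = mat_inner (transpose_mat (M * V)) (transpose_mat (N * V))"
    using Vc M N by (intro mat_inner_transpose[symmetric]) auto
  also have "\<dots> = mat_inner (transpose_mat V * transpose_mat M) (transpose_mat V * transpose_mat N)"
    using Vc M N by (simp add: transpose_mult[of _ m n _ n])
  also have "\<dots> = mat_inner (transpose_mat M) (transpose_mat N)"
    using orthogonal_square_mat_transpose[OF V] M N by (intro mat_inner_orthogonal_left) auto
  also have "\<dots> = mat_inner M N" using M N by (rule mat_inner_transpose)
  finally show ?thesis .
qed

lemma mat_inner_le_frobenius:
  assumes "M \<in> carrier_mat m n" "N \<in> carrier_mat m n"
  shows "mat_inner M N \<le> frobenius_norm M * frobenius_norm N"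
proof -
  have norm: "frobenius_norm X = L2_set (\<lambda>p. X $$ p) ({..<m} \<times> {..<n})"
    if "X \<in> carrier_mat m n" for X
    using that by (simp add: frobenius_norm_def L2_set_def sum.cartesian_product case_prod_beta)
  have "mat_inner M N = (\<Sum>p\<in>{..<m} \<times> {..<n}. M $$ p * N $$ p)"
    using assms by (simp add: mat_inner_def sum.cartesian_product case_prod_beta)
  then show ?thesis using sum_mult_le_L2_set norm assms by simp
qed

text \<open>
  One half of the duality between the operator norm and the nuclear norm. The inner
  product can be computed columnwise in any orthonormal basis; in an eigenbasis of \<open>L\<^sup>T L\<close> the columns
  of \<open>L\<close> have the singular values as lengths, and Cauchy-Schwarz in each column suffices.
\<close>
lemma mat_inner_le_nuclear_norm:
  assumes Z: "Z \<in> carrier_mat m n" and L: "L \<in> carrier_mat m n"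
    and bound: "\<And>x. x \<in> carrier_vec n \<Longrightarrow> l2_norm (Z *\<^sub>v x) \<le> \<rho> * l2_norm x"
  shows "mat_inner Z L \<le> \<rho> * nuclear_norm L"
proof -
  let ?B = "transpose_mat L * L"
  have B: "?B \<in> carrier_mat n n" using L by simp
  have "transpose_mat ?B = ?B" using L by (simp add: transpose_mult[of _ n m _ n])
  then obtain Q d where Q: "orthogonal_square_mat n Q"
    and diag: "transpose_mat Q * ?B * Q = mat_diag n d"
    using real_spectral_theorem[OF B] by auto
  have Qc: "Q \<in> carrier_mat n n" and QQ: "transpose_mat Q * Q = 1\<^sub>m n"
    using Q by (auto simp: orthogonal_square_mat_def)
  have unit: "l2_norm (col Q j) = 1" if "j < n" for j
  proof -
    have "col Q j \<bullet> col Q j = (transpose_mat Q * Q) $$ (j, j)" using Qc that by simp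
    then show ?thesis
      using that l2_norm_power2[of "col Q j"] by (simp add: QQ power2_eq_1_iff l2_norm_def sum_nonneg)
  qed
  have singular: "l2_norm (L *\<^sub>v col Q j) = sqrt (d j)" if "j < n" for j
  proof -
    have "transpose_mat (L * Q) * (L * Q) = mat_diag n d"
      using L Qc by (simp add: diag[symmetric] transpose_mult[of _ m n _ n]
          assoc_mult_mat[of _ n m _ n _ n] assoc_mult_mat[of _ n n _ m _ n] assoc_mult_mat[of _ n n _ n _ n])
    then have "d j = (transpose_mat (L * Q) * (L * Q)) $$ (j, j)"
      using that by (simp add: mat_diag_def)
    also have "\<dots> = col (L * Q) j \<bullet> col (L * Q) j" using that L Qc by simp
    finally have "d j = (L *\<^sub>v col Q j) \<bullet> (L *\<^sub>v col Q j)"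
      using that L Qc by (simp add: col_mult2[of _ m n _ n] del: col_mult)
    then show ?thesis
      using l2_norm_power2[of "L *\<^sub>v col Q j"]
      by (metis l2_norm_def real_sqrt_ge_0_iff real_sqrt_unique sum_nonneg zero_le_power2)
  qed
  have "mat_inner Z L = mat_inner (Z * Q) (L * Q)"
    using mat_inner_orthogonal_right[OF Q Z L] by simp
  also have "\<dots> = (\<Sum>j<n. (Z *\<^sub>v col Q j) \<bullet> (L *\<^sub>v col Q j))"
    using Z L Qc by (subst mat_inner_cols[of _ m n]) (auto simp: col_mult2[of _ m n _ n] simp del: col_mult)
  also have "\<dots> \<le> (\<Sum>j<n. \<rho> * sqrt (d j))"
  proof (rule sum_mono)
    fix j assume "j \<in> {..<n}"
    then have j: "j < n" by simp
    have q: "col Q j \<in> carrier_vec n" using Qc j by auto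
    have "(Z *\<^sub>v col Q j) \<bullet> (L *\<^sub>v col Q j) \<le> l2_norm (Z *\<^sub>v col Q j) * l2_norm (L *\<^sub>v col Q j)"
      using Z L q by (intro scalar_prod_le_l2_norm[of _ m]) auto
    also have "\<dots> \<le> \<rho> * l2_norm (L *\<^sub>v col Q j)"
      using bound[OF q] unit[OF j] by (intro mult_right_mono) (auto simp: l2_norm_def sum_nonneg)
    finally show "(Z *\<^sub>v col Q j) \<bullet> (L *\<^sub>v col Q j) \<le> \<rho> * sqrt (d j)"
      by (simp add: singular[OF j])
  qed
  also have "\<dots> = \<rho> * nuclear_norm L"
    by (simp add: nuclear_norm_diagonalized[OF L Q diag] sum_distrib_left)
  finally show ?thesis .
qed

section \<open>Matrices with a given singular value decomposition\<close>

lemma rect_diag_eq: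
  assumes "v \<in> carrier_vec n" "n \<le> m"
  shows "rect_diag m v = mat m n (\<lambda>(i, j). if i = j then v $ j else 0)"
  using assms by (intro eq_matI) (auto simp: rect_diag_def Diag_def append_rows_def mat_diag_def)

lemma rect_diag_carrier: "v \<in> carrier_vec n \<Longrightarrow> n \<le> m \<Longrightarrow> rect_diag m v \<in> carrier_mat m n"
  by (simp add: rect_diag_eq)

lemma mat_inner_rect_diag:
  assumes "u \<in> carrier_vec n" "v \<in> carrier_vec n" "n \<le> m"
  shows "mat_inner (rect_diag m u) (rect_diag m v) = u \<bullet> v"
proof -
  have "mat_inner (rect_diag m u) (rect_diag m v)
      = (\<Sum>j<n. \<Sum>i<m. rect_diag m u $$ (i, j) * rect_diag m v $$ (i, j))"
    using assms unfolding mat_inner_def by (subst sum.swap) (simp add: rect_diag_eq)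
  also have "\<dots> = (\<Sum>j<n. \<Sum>i<m. if i = j then u $ j * v $ j else 0)"
  proof (rule sum.cong[OF refl], rule sum.cong[OF refl])
    fix i j assume "j \<in> {..<n}" "i \<in> {..<m}"
    then show "rect_diag m u $$ (i, j) * rect_diag m v $$ (i, j) = (if i = j then u $ j * v $ j else 0)"
      using assms by (simp add: rect_diag_eq)
  qed
  finally show ?thesis using assms by (simp add: scalar_prod_def atLeast0LessThan)
qed

lemma rect_diag_minus:
  assumes "u \<in> carrier_vec n" "v \<in> carrier_vec n" "n \<le> m"
  shows "rect_diag m u - rect_diag m v = rect_diag m (u - v)"
  using assms by (auto simp: rect_diag_eq[of _ n] intro!: eq_matI)

lemma rect_diag_gram:
  assumes "v \<in> carrier_vec n" "n \<le> m"
  shows "transpose_mat (rect_diag m v) * rect_diag m v = mat_diag n (\<lambda>i. (v $ i)\<^sup>2)"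
proof (rule eq_matI)
  fix i j assume "i < dim_row (mat_diag n (\<lambda>i. (v $ i)\<^sup>2))" "j < dim_col (mat_diag n (\<lambda>i. (v $ i)\<^sup>2))"
  then have ij: "i < n" "j < n" by (auto simp: mat_diag_def)
  have "(transpose_mat (rect_diag m v) * rect_diag m v) $$ (i, j)
      = (\<Sum>k<m. rect_diag m v $$ (k, i) * rect_diag m v $$ (k, j))"
    using ij assms by (simp add: rect_diag_eq scalar_prod_def atLeast0LessThan)
  also have "\<dots> = (\<Sum>k<m. if k = i then (if i = j then (v $ i)\<^sup>2 else 0) else 0)"
    using ij assms by (intro sum.cong refl) (simp add: rect_diag_eq power2_eq_square)
  finally show "(transpose_mat (rect_diag m v) * rect_diag m v) $$ (i, j)
      = mat_diag n (\<lambda>i. (v $ i)\<^sup>2) $$ (i, j)"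
    using ij assms by (simp add: mat_diag_def)
qed (use assms in \<open>auto simp: rect_diag_eq mat_diag_def\<close>)

text \<open>
  Lengths are invariant under orthogonal matrices, so this carries the entrywise bound on \<open>u\<close> over to
  the operator norm of the certificate \<open>U (Diag u; 0) V\<^sup>T\<close>.
\<close>
lemma l2_norm_rect_diag_mult_le:
  assumes u: "u \<in> carrier_vec n" and bound: "\<forall>i<n. \<bar>u $ i\<bar> \<le> \<rho>" and "\<rho> > 0"
    and x: "x \<in> carrier_vec n" and nm: "n \<le> m"
  shows "l2_norm (rect_diag m u *\<^sub>v x) \<le> \<rho> * l2_norm x"
proof (rule power2_le_imp_le)
  have R: "rect_diag m u \<in> carrier_mat m n" using u nm by (rule rect_diag_carrier)
  have "(l2_norm (rect_diag m u *\<^sub>v x))\<^sup>2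
      = x \<bullet> ((transpose_mat (rect_diag m u) * rect_diag m u) *\<^sub>v x)"
    using R x adjoint_scalar_prod[OF R x, of "rect_diag m u *\<^sub>v x"]
    by (simp add: l2_norm_power2 assoc_mult_mat_vec[of _ n m _ n])
  also have "\<dots> = (\<Sum>i<n. (u $ i)\<^sup>2 * (x $ i)\<^sup>2)"
  proof -
    have "mat_diag n (\<lambda>i. (u $ i)\<^sup>2) *\<^sub>v x = vec n (\<lambda>i. (u $ i)\<^sup>2 * x $ i)"
    proof (rule eq_vecI)
      fix i assume "i < dim_vec (vec n (\<lambda>i. (u $ i)\<^sup>2 * x $ i))"
      then have i: "i < n" by simp
      have "(mat_diag n (\<lambda>i. (u $ i)\<^sup>2) *\<^sub>v x) $ i
          = (\<Sum>j<n. (if i = j then (u $ j)\<^sup>2 else 0) * x $ j)"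
        using i x by (simp add: mat_diag_def scalar_prod_def atLeast0LessThan)
      also have "\<dots> = (\<Sum>j<n. if i = j then (u $ j)\<^sup>2 * x $ j else 0)"
        by (intro sum.cong) auto
      finally show "(mat_diag n (\<lambda>i. (u $ i)\<^sup>2) *\<^sub>v x) $ i = vec n (\<lambda>i. (u $ i)\<^sup>2 * x $ i) $ i"
        using i by simp
    qed (simp add: mat_diag_def)
    then show ?thesis
      using x by (simp add: rect_diag_gram[OF u nm] scalar_prod_def atLeast0LessThan
          power2_eq_square mult.assoc mult.left_commute)
  qed
  also have "\<dots> \<le> (\<Sum>i<n. \<rho>\<^sup>2 * (x $ i)\<^sup>2)"
  proof (intro sum_mono mult_right_mono)
    fix i assume "i \<in> {..<n}"
    then show "(u $ i)\<^sup>2 \<le> \<rho>\<^sup>2" using bound \<open>\<rho> > 0\<close> by (simp add: abs_le_square_iff[symmetric])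
  qed simp
  also have "\<dots> = (\<rho> * l2_norm x)\<^sup>2"
    using x by (simp add: power_mult_distrib l2_norm_def sum_nonneg sum_distrib_left)
  finally show "(l2_norm (rect_diag m u *\<^sub>v x))\<^sup>2 \<le> (\<rho> * l2_norm x)\<^sup>2" .
  show "0 \<le> \<rho> * l2_norm x" using \<open>\<rho> > 0\<close> by (simp add: l2_norm_def sum_nonneg)
qed

lemma l2_norm_orthogonal:
  assumes "orthogonal_square_mat n Q" "x \<in> carrier_vec n"
  shows "l2_norm (Q *\<^sub>v x) = l2_norm x"
proof -
  have "(l2_norm (Q *\<^sub>v x))\<^sup>2 = (l2_norm x)\<^sup>2"
    using assms by (simp add: l2_norm_power2 orthogonal_scalar_prod)
  then show ?thesis by (simp add: l2_norm_def sum_nonneg)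
qed

lemma svd_carrier:
  assumes "orthogonal_square_mat m U" "orthogonal_square_mat n V" "v \<in> carrier_vec n" "n \<le> m"
  shows "U * rect_diag m v * transpose_mat V \<in> carrier_mat m n"
  using assms by (auto simp: orthogonal_square_mat_def intro!: mult_carrier_mat rect_diag_carrier)

lemma mat_inner_svd:
  assumes U: "orthogonal_square_mat m U" and V: "orthogonal_square_mat n V"
    and u: "u \<in> carrier_vec n" and v: "v \<in> carrier_vec n" and nm: "n \<le> m"
  shows "mat_inner (U * rect_diag m u * transpose_mat V) (U * rect_diag m v * transpose_mat V) = u \<bullet> v"
proof -
  have Uc: "U \<in> carrier_mat m m" using U by (simp add: orthogonal_square_mat_def)
  note R = rect_diag_carrier[OF u nm] rect_diag_carrier[OF v nm]
  show ?thesis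
    using Uc R u v nm
    by (subst mat_inner_orthogonal_right[OF orthogonal_square_mat_transpose[OF V], of _ m])
      (auto simp: mat_inner_orthogonal_left[OF U] mat_inner_rect_diag)
qed

lemma frobenius_norm_svd:
  assumes "orthogonal_square_mat m U" "orthogonal_square_mat n V" "v \<in> carrier_vec n" "n \<le> m"
  shows "frobenius_norm (U * rect_diag m v * transpose_mat V) = l2_norm v"
proof -
  have "v \<bullet> v = (l2_norm v)\<^sup>2" by (rule l2_norm_power2[symmetric])
  then show ?thesis
    using assms by (simp add: frobenius_norm_eq_sqrt mat_inner_svd) (simp add: l2_norm_def sum_nonneg)
qed

text \<open>
  The orthogonal factor \<open>V\<close> diagonalizes \<open>X\<^sup>T X\<close> for \<open>X = U (Diag v; 0) V\<^sup>T\<close>, with the squares of the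
  entries of \<open>v\<close> on the diagonal. The entries may be negative, whence the absolute values in \<open>l1_norm\<close>.
\<close>
lemma nuclear_norm_svd:
  assumes U: "orthogonal_square_mat m U" and V: "orthogonal_square_mat n V"
    and v: "v \<in> carrier_vec n" and nm: "n \<le> m"
  shows "nuclear_norm (U * rect_diag m v * transpose_mat V) = l1_norm v"
proof -
  let ?R = "rect_diag m v"
  let ?X = "U * ?R * transpose_mat V"
  have Uc: "U \<in> carrier_mat m m" and UU: "transpose_mat U * U = 1\<^sub>m m"
    and Vc: "V \<in> carrier_mat n n" and VV: "transpose_mat V * V = 1\<^sub>m n"
    using U V by (auto simp: orthogonal_square_mat_def)
  have R: "?R \<in> carrier_mat m n" using v nm by (rule rect_diag_carrier)
  have X: "?X \<in> carrier_mat m n" using svd_carrier[OF assms] .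
  have "?X * V = U * ?R * (transpose_mat V * V)"
    using Uc R Vc by (intro assoc_mult_mat[of _ m n _ n _ n]) auto
  then have XV: "?X * V = U * ?R" using Uc R by (simp add: VV)
  have "transpose_mat V * (transpose_mat ?X * ?X) * V = transpose_mat (?X * V) * (?X * V)"
    using X Vc by (simp add: transpose_mult[of _ m n _ n] assoc_mult_mat[of _ n m _ n _ n]
        assoc_mult_mat[of _ n n _ m _ n] assoc_mult_mat[of _ n n _ n _ n] del: transpose_mult)
  also have "\<dots> = transpose_mat ?R * (transpose_mat U * U * ?R)"
    using Uc R by (simp add: XV transpose_mult[of _ m m _ n] assoc_mult_mat[of _ n m _ m _ n]
        assoc_mult_mat[of _ m m _ m _ n])
  also have "\<dots> = mat_diag n (\<lambda>i. (v $ i)\<^sup>2)"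
    using R by (simp add: UU rect_diag_gram[OF v nm])
  finally have "nuclear_norm ?X = (\<Sum>i<n. sqrt ((v $ i)\<^sup>2))"
    by (rule nuclear_norm_diagonalized[OF X V])
  then show ?thesis using v by (simp add: l1_norm_def)
qed

lemma svd_minus:
  assumes U: "orthogonal_square_mat m U" and V: "orthogonal_square_mat n V"
    and u: "u \<in> carrier_vec n" and v: "v \<in> carrier_vec n" and nm: "n \<le> m"
  shows "U * rect_diag m u * transpose_mat V - U * rect_diag m v * transpose_mat V
    = U * rect_diag m (u - v) * transpose_mat V"
proof -
  have Uc: "U \<in> carrier_mat m m" and Vc: "V \<in> carrier_mat n n"
    using U V by (auto simp: orthogonal_square_mat_def)
  note R = rect_diag_carrier[OF u nm] rect_diag_carrier[OF v nm]
  show ?thesis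
    using Uc Vc R
    by (simp add: rect_diag_minus[OF u v nm, symmetric] minus_mult_distrib_mat[of _ m n]
        mult_minus_distrib_mat[of _ m m _ n])
qed

section \<open>Optimality of the matrix solution\<close>

theorem theorem3:
  fixes n1 n2 :: nat and \<rho> :: real and A U V :: "real mat" and \<sigma> :: "real vec"
  assumes "n1 \<ge> n2" and "\<rho> > 0"
    and "A \<in> carrier_mat n1 n2" and "A \<noteq> 0\<^sub>m n1 n2"
    and "orthogonal_square_mat n1 U" and "orthogonal_square_mat n2 V"
    and "\<sigma> \<in> carrier_vec n2"
    and "\<forall>i j. i \<le> j \<longrightarrow> j < n2 \<longrightarrow> \<sigma> $ i \<ge> \<sigma> $ j"
    and "\<forall>i<n2. \<sigma> $ i \<ge> 0"
    and "A = U * rect_diag n1 \<sigma> * transpose_mat V"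
  shows "is_arg_min (\<lambda>L. frobenius_norm (L - A) + \<rho> * nuclear_norm L)
           (\<lambda>L. L \<in> carrier_mat n1 n2)
           (U * rect_diag n1 (d_vec \<rho> \<sigma>) * transpose_mat V)"
proof -
  note nm = assms(1) and A = assms(3) and U = assms(5) and V = assms(6) and \<sigma> = assms(7)
  let ?F = "\<lambda>L. frobenius_norm (L - A) + \<rho> * nuclear_norm L"
  let ?svd = "\<lambda>v. U * rect_diag n1 v * transpose_mat V"
  have Uc: "U \<in> carrier_mat n1 n1" and Vc: "V \<in> carrier_mat n2 n2"
    using U V by (auto simp: orthogonal_square_mat_def)
  have "\<sigma> \<noteq> 0\<^sub>v n2"
  proof
    assume "\<sigma> = 0\<^sub>v n2"
    then have "rect_diag n1 \<sigma> = 0\<^sub>m n1 n2" using nm by (auto simp: rect_diag_eq[of _ n2])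
    then show False using assms(4,10) Uc Vc by simp
  qed
  then obtain u where d: "d_vec \<rho> \<sigma> \<in> carrier_vec n2" and u: "u \<in> carrier_vec n2"
    and u_norm: "l2_norm u \<le> 1" and u_bound: "\<forall>i<n2. \<bar>u $ i\<bar> \<le> \<rho>"
    and tight: "l2_norm (d_vec \<rho> \<sigma> - \<sigma>) + \<rho> * l1_norm (d_vec \<rho> \<sigma>) = u \<bullet> \<sigma>"
    using d_vec_certificate[OF \<sigma> assms(9) _ assms(2)] by auto
  have Z: "?svd u \<in> carrier_mat n1 n2" using svd_carrier[OF U V u nm] .
  have "u \<bullet> \<sigma> \<le> ?F L" if L: "L \<in> carrier_mat n1 n2" for L
  proof -
    have "mat_inner (?svd u) (A - L) \<le> frobenius_norm (?svd u) * frobenius_norm (A - L)"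
      using A L by (intro mat_inner_le_frobenius[OF Z]) auto
    also have "\<dots> \<le> 1 * frobenius_norm (A - L)"
    proof (rule mult_right_mono)
      show "frobenius_norm (?svd u) \<le> 1" using u_norm by (simp only: frobenius_norm_svd[OF U V u nm])
      show "0 \<le> frobenius_norm (A - L)" by (simp add: frobenius_norm_def sum_nonneg)
    qed
    also have "\<dots> = frobenius_norm (L - A)"
      using A L by (simp add: frobenius_norm_def power2_commute)
    finally have "mat_inner (?svd u) A - mat_inner (?svd u) L \<le> frobenius_norm (L - A)"
      by (simp add: mat_inner_minus_right[OF Z A L])
    moreover have "mat_inner (?svd u) L \<le> \<rho> * nuclear_norm L"
    proof (rule mat_inner_le_nuclear_norm[OF Z L])
      fix x :: "real vec" assume x: "x \<in> carrier_vec n2"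
      let ?y = "transpose_mat V *\<^sub>v x"
      have y: "?y \<in> carrier_vec n2" using Vc x by simp
      have R: "rect_diag n1 u \<in> carrier_mat n1 n2" using u nm by (rule rect_diag_carrier)
      have "?svd u *\<^sub>v x = (U * rect_diag n1 u) *\<^sub>v ?y"
        using Uc R Vc x by (intro assoc_mult_mat_vec[of _ n1 n2 _ n2]) auto
      also have "\<dots> = U *\<^sub>v (rect_diag n1 u *\<^sub>v ?y)"
        using Uc R y by (intro assoc_mult_mat_vec[of _ n1 n1 _ n2]) auto
      finally have "l2_norm (?svd u *\<^sub>v x) = l2_norm (rect_diag n1 u *\<^sub>v ?y)"
        using R y by (simp add: l2_norm_orthogonal[OF U])
      also have "\<dots> \<le> \<rho> * l2_norm ?y"
        by (rule l2_norm_rect_diag_mult_le[OF u u_bound assms(2) y nm])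
      also have "l2_norm ?y = l2_norm x"
        by (rule l2_norm_orthogonal[OF orthogonal_square_mat_transpose[OF V] x])
      finally show "l2_norm (?svd u *\<^sub>v x) \<le> \<rho> * l2_norm x" .
    qed
    moreover have "mat_inner (?svd u) A = u \<bullet> \<sigma>"
      unfolding assms(10) by (rule mat_inner_svd[OF U V u \<sigma> nm])
    ultimately show ?thesis by linarith
  qed
  moreover have "?F (?svd (d_vec \<rho> \<sigma>)) = u \<bullet> \<sigma>"
  proof -
    have "?svd (d_vec \<rho> \<sigma>) - A = ?svd (d_vec \<rho> \<sigma> - \<sigma>)"
      unfolding assms(10) by (rule svd_minus[OF U V d \<sigma> nm])
    moreover have "d_vec \<rho> \<sigma> - \<sigma> \<in> carrier_vec n2" using d \<sigma> by simp
    ultimately show ?thesis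
      by (simp add: frobenius_norm_svd[OF U V _ nm] nuclear_norm_svd[OF U V d nm] tight)
  qed
  ultimately show ?thesis
    using svd_carrier[OF U V d nm] by (simp add: is_arg_min_def not_less)
qed

end
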